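(* Let $T>0$ and let $u^{\mathrm{in}}$ be the incident field generated by a moving point emitter with strength $\varphi$ and trajectory $\mathbf{z}$. Consider two moving point scatterers with parameters $(\alpha_j,\mathbf{y}_j)$, $j=1,2$, such that $\alpha_j\in(m_\alpha,M_\alpha)\subset(0,\infty)$, $\mathbf{y}_j\in C^1([0,T];\mathbb{R}^3)$ with $\|\dot{\mathbf{y}}_j\|_{C^0([0,T];\mathbb{R}^3)}\le c_0$, and $\mathbf{y}_j(t)\in\Omega_1$ for all $t\in[0,T]$, where $\Omega_1\subset\mathbb{R}^3$ is a compact set with $d_{\mathrm{in}}:=\operatorname{dist}(\Omega_1,\{\mathbf{z}(t):t\in[0,T]\})>0$. Let $q_j\in C^1([0,T])$ be the unique solution of $$q_j'(t)+4\pi c\alpha_j q_j(t)=4\pi c\,u^{\mathrm{in}}(\mathbf{y}_j(t),t),\qquad q_j(0)=0,\quad j=1,2.$$ Let $\Omega_2\subset\mathbb{R}^3$ be a compact set satisfying $$d_{\mathrm{sc}}:=\inf_{\mathbf{x}\in\Omega_2,\;t\in[0,T],\;j=1,2}|\mathbf{x}-\mathbf{y}_j(t)|>0,$$ and let $u_j^{\mathrm{sc}}$ be the scattered field generated by the $j$-th scatterer, $$u^{\mathrm{sc}}_j(\mathbf{x},t)=\frac{H\bigl(t-|\mathbf{x}-\mathbf{y}_j(0)|/c\bigr)}{4\pi|\mathbf{x}-\mathbf{y}_j(\tau_{2,j}(\mathbf{x},t))|}\,q_j(\tau_{2,j}(\mathbf{x},t)),$$ where $\tau_{2,j}(\mathbf{x},t)$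 solves $t-\tau_{2,j}-|\mathbf{x}-\mathbf{y}_j(\tau_{2,j})|/c=0$. Then there exists a constant $C_{\mathrm{sc}}=C_{\mathrm{sc}}(c,c_0,m_\alpha,M_\alpha,d_{\mathrm{in}},d_{\mathrm{sc}},\varphi,\mathbf{z},T)>0$, depending only on the listed quantities, such that for every $\mathbf{x}\in\Omega_2$ and every $t\in[0,T]$, $$\bigl|u^{\mathrm{sc}}_1(\mathbf{x},t)-u^{\mathrm{sc}}_2(\mathbf{x},t)\bigr|\le C_{\mathrm{sc}}\Bigl(|\alpha_1-\alpha_2|+\|\mathbf{y}_1-\mathbf{y}_2\|_{C^0([0,T];\mathbb{R}^3)}\Bigr).$$
   Context: $c>0$ is the wave speed and $c_0\in(0,c)$. $H$ is the Heaviside step function, with $H(s)=1$ for $s\ge0$ and $H(s)=0$ for $s<0$; a product with a vanishing Heaviside factor is $0$ (the retarded time is only needed when the factor equals $1$). The emitter has strength $\varphi>0$, $\varphi\in C^1([0,T])$, and $C^1$ trajectory $\mathbf{z}$ with $|\dot{\mathbf{z}}(t)|<c_0$. The incident field is $$u^{\mathrm{in}}(\mathbf{x},t)=\frac{H\bigl(t-|\mathbf{x}-\mathbf{z}(0)|/c\bigr)}{4\pi|\mathbf{x}-\mathbf{z}(\tau_1(\mathbf{x},t))|}\,\varphi(\tau_1(\mathbf{x},t)),$$ where $\tau_1(\mathbf{x},t)\ge 0$ is the solution of $t-\tau_1-|\mathbf{x}-\mathbf{z}(\tau_1)|/c=0$. Norm: $\|g\|_{C^0([0,T];\mathbb{R}^3)}=\sup_{t\in[0,T]}|g(t)|$.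 *)

theory Defs
  imports "HOL-Analysis.Analysis"
begin

text \<open>Trajectories and amplitudes are total functions on \<^typ>\<open>real\<close> of which only the values on
  \<open>[0,T]\<close> matter; derivatives at the end points are one-sided.\<close>

definition C1_upto :: "real \<Rightarrow> (real \<Rightarrow> 'a::real_normed_vector) \<Rightarrow> bool" where
  "C1_upto T f \<longleftrightarrow>
     (\<forall>t\<in>{0..T}. f differentiable (at t within {0..T})) \<and>
     continuous_on {0..T} (\<lambda>t. vector_derivative f (at t within {0..T}))"

definition velocity :: "real \<Rightarrow> (real \<Rightarrow> 'a::real_normed_vector) \<Rightarrow> real \<Rightarrow> 'a" where
  "velocity T f t = vector_derivative f (at t within {0..T})"

definition C0_norm :: "real \<Rightarrow> (real \<Rightarrow> 'a::real_normed_vector) \<Rightarrow> real" where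
  "C0_norm T g = (SUP t\<in>{0..T}. norm (g t))"

definition heaviside :: "real \<Rightarrow> real" where
  "heaviside s = (if s \<ge> 0 then 1 else 0)"

text \<open>The equation forces \<open>\<tau> \<le> t\<close>, so only the trajectory on \<open>[0,t]\<close> is inspected. A solution
  exists exactly when the Heaviside factor below is 1 (for subsonic trajectories); otherwise the
  description is arbitrary, but it is then multiplied by 0.\<close>

definition retarded_time :: "real \<Rightarrow> (real \<Rightarrow> real^3) \<Rightarrow> real^3 \<Rightarrow> real \<Rightarrow> real" where
  "retarded_time c p x t = (THE \<tau>. \<tau> \<ge> 0 \<and> t - \<tau> - norm (x - p \<tau>) / c = 0)"

text \<open>Field of a point source of strength \<open>s\<close> moving along \<open>p\<close>. The incident field is the case
  \<open>s = \<phi>\<close>, \<open>p = z\<close>, the scattered field of the \<open>j\<close>-th scatterer the case \<open>s = q\<^sub>j\<close>, \<open>p = y\<^sub>j\<close>.\<close>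

definition moving_source_field ::
    "real \<Rightarrow> (real \<Rightarrow> real) \<Rightarrow> (real \<Rightarrow> real^3) \<Rightarrow> real^3 \<Rightarrow> real \<Rightarrow> real" where
  "moving_source_field c s p x t =
     heaviside (t - norm (x - p 0) / c) / (4 * pi * norm (x - p (retarded_time c p x t)))
       * s (retarded_time c p x t)"

text \<open>Since \<open>\<phi> 0 > 0\<close>, the incident field jumps across the wave front \<open>c t = |x - z 0|\<close>. Hence no
  function can satisfy the amplitude equation at the time when this front reaches the scatterer
  (a derivative has no jumps). The equation is therefore required at all other times, and
  continuity at all times. This determines \<open>q\<close> uniquely on \<open>[0,T]\<close> when the scatterer is slower
  than \<open>c\<close>; it is \<open>C\<^sup>1\<close> on either side of that single time, and on all of \<open>[0,T]\<close> if the front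
  does not arrive. Every classical \<open>C\<^sup>1\<close> solution is a solution in this sense, as proved below.\<close>

definition scatterer_amplitude ::
    "real \<Rightarrow> real \<Rightarrow> (real \<Rightarrow> real) \<Rightarrow> (real \<Rightarrow> real^3) \<Rightarrow>
     real \<Rightarrow> (real \<Rightarrow> real^3) \<Rightarrow> (real \<Rightarrow> real) \<Rightarrow> bool" where
  "scatterer_amplitude c T \<phi> z \<alpha> y q \<longleftrightarrow>
     continuous_on {0..T} q \<and> q 0 = 0 \<and>
     (\<forall>t\<in>{0..T}. t \<noteq> norm (y t - z 0) / c \<longrightarrow>
        q differentiable (at t within {0..T}) \<and>
        velocity T q t + 4 * pi * c * \<alpha> * q t
          = 4 * pi * c * moving_source_field c \<phi> z (y t) t)"

lemma classical_imp_scatterer_amplitude: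
  assumes "C1_upto T q" and "q 0 = 0"
    and "\<And>t. t \<in> {0..T} \<Longrightarrow>
      velocity T q t + 4 * pi * c * \<alpha> * q t = 4 * pi * c * moving_source_field c \<phi> z (y t) t"
  shows "scatterer_amplitude c T \<phi> z \<alpha> y q"
proof -
  have d: "q differentiable (at t within {0..T})" if "t \<in> {0..T}" for t
    using assms(1) that by (simp add: C1_upto_def)
  then have "continuous_on {0..T} q"
    by (simp add: continuous_on_eq_continuous_within differentiable_imp_continuous_within)
  with d assms(2,3) show ?thesis
    by (simp add: scatterer_amplitude_def)
qed

end

theory Submission
  imports Defs
begin

text \<open>Throughout, trajectories are subsonic, and \<open>\<delta>\<close> is the uniform distance of the two
  scatterer trajectories.

  Retarded times are stable because trajectories are subsonic. The range \<open>|x - p \<tau>|\<close> from an observer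
  to a source with speed at most \<open>L < c\<close> changes by at most \<open>L\<close> per unit of emission time, whereas
  the range reached by the signal changes by \<open>c\<close>. The retarded time is the crossing of the two, and
  so it moves by at most \<open>\<delta> / (c - L)\<close> when all ranges move by at most \<open>\<delta>\<close>
  (\<open>retarded_time_stability\<close>). A field with Lipschitz strength inherits this at a distance from its
  source, as long as both signals have arrived (\<open>moving_source_field_stability\<close>).

  The incident field jumps at its wave front, so the forcing terms of the two scatterers are not
  uniformly close. They are close except when the front has passed exactly one scatterer. The front
  overtakes every scatterer at relative speed at least \<open>c - L\<close>, so this lasts only for a time of
  order \<open>\<delta>\<close> (\<open>arrival_mismatch_window\<close>), during which the forcing terms are still bounded.
  The amplitude equation integrates the forcing, and hence the amplitudes differ uniformly by
  \<open>O(|\<alpha>1 - \<alpha>2| + \<delta>)\<close> (\<open>scatterer_amplitude_stability\<close>). The damping has the good sign, so no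
  exponential of the data enters.

  The scattered field has no such jump. An amplitude starts from 0 and is Lipschitz, so a scattered
  field that has arrived at an observer while the other one has not is itself of order \<open>\<delta>\<close>
  (\<open>continuous_strength_field_near_front\<close>). Stability of amplitudes and of retarded times then
  gives the estimate.\<close>

section \<open>Continuously differentiable trajectories\<close>

lemma C1_upto_continuous_on:
  assumes "C1_upto T f"
  shows "continuous_on {0..T} f"
  using assms differentiable_imp_continuous_within
  by (force simp: C1_upto_def continuous_on_eq_continuous_within)

lemma C1_upto_lipschitz_on:
  fixes f :: "real \<Rightarrow> 'a::real_normed_vector"
  assumes "C1_upto T f" and "\<And>t. t \<in> {0..T} \<Longrightarrow> norm (velocity T f t) \<le> L" and "0 \<le> L"
  shows "L-lipschitz_on {0..T} f"
proof (rule bounded_derivative_imp_lipschitz)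
  fix t assume t: "t \<in> {0..T}"
  then have "(f has_vector_derivative velocity T f t) (at t within {0..T})"
    using assms(1) by (simp add: C1_upto_def velocity_def vector_derivative_works)
  then show "(f has_derivative (\<lambda>h. h *\<^sub>R velocity T f t)) (at t within {0..T})"
    by (simp add: has_vector_derivative_def)
  show "onorm (\<lambda>h. h *\<^sub>R velocity T f t) \<le> L"
    using mult_right_mono[OF assms(2)[OF t] abs_ge_zero] by (intro onorm_le) (simp add: mult.commute)
qed (use assms(3) in auto)

lemma norm_le_C0_norm:
  assumes "continuous_on {0..T} g" and "t \<in> {0..T}"
  shows "norm (g t) \<le> C0_norm T g"
proof -
  have "compact ((\<lambda>t. norm (g t)) ` {0..T})"
    using assms(1) by (intro compact_continuous_image continuous_on_norm) auto
  then have "bdd_above ((\<lambda>t. norm (g t)) ` {0..T})"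
    by (intro bounded_imp_bdd_above compact_imp_bounded)
  then show ?thesis
    unfolding C0_norm_def using assms(2) by (rule cSUP_upper[rotated])
qed

lemma C1_upto_lipschitz_on_C0_norm:
  assumes "C1_upto T f" and "C0_norm T (velocity T f) \<le> L" and "0 \<le> L"
  shows "L-lipschitz_on {0..T} f"
proof (rule C1_upto_lipschitz_on[OF assms(1) _ assms(3)])
  have "continuous_on {0..T} (velocity T f)"
    using assms(1) by (simp add: C1_upto_def velocity_def[abs_def])
  then show "norm (velocity T f t) \<le> L" if "t \<in> {0..T}" for t
    using norm_le_C0_norm[OF _ that] assms(2) by fastforce
qed

section \<open>Retarded times and fields of subsonic sources\<close>

text \<open>Read with \<open>x\<close> as observer, this bounds how fast the range to a moving source can change. All
  uses of subsonic speed go through this inequality.\<close>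

lemma range_dist_lipschitz:
  fixes p :: "real \<Rightarrow> 'a::real_normed_vector"
  assumes "L-lipschitz_on S p" and "s \<in> S" and "s' \<in> S"
  shows "\<bar>norm (x - p s) - norm (x - p s')\<bar> \<le> L * \<bar>s - s'\<bar>"
proof -
  have "\<bar>norm (x - p s) - norm (x - p s')\<bar> \<le> norm (p s - p s')"
    using norm_triangle_ineq3[of "x - p s" "x - p s'"] by (simp add: norm_minus_commute)
  also have "\<dots> \<le> L * \<bar>s - s'\<bar>"
    using lipschitz_onD[OF assms] by (simp add: dist_norm)
  finally show ?thesis .
qed

text \<open>While \<open>\<tau>\<close> runs from 0 to \<open>t\<close>, the quantity \<open>c \<tau> + |x - p \<tau>|\<close> passes from at most \<open>c t\<close> to at least
  \<open>c t\<close>, which gives a retarded time. It is the only one because that quantity increases with slope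
  at least \<open>c - L\<close>. Hence the definite description denotes it once the signal has arrived.\<close>

lemma retarded_time_arrived:
  assumes lip: "L-lipschitz_on {0..T} p" and "L < c" and t: "t \<in> {0..T}"
    and arrived: "norm (x - p 0) \<le> c * t"
  shows "0 \<le> retarded_time c p x t" and "retarded_time c p x t \<le> t"
    and "norm (x - p (retarded_time c p x t)) = c * (t - retarded_time c p x t)"
proof -
  have L: "0 \<le> L" using lip by (rule lipschitz_on_nonneg)
  with \<open>L < c\<close> have c: "c > 0" by simp
  let ?P = "\<lambda>\<tau>. \<tau> \<ge> 0 \<and> t - \<tau> - norm (x - p \<tau>) / c = 0"
  have P_iff: "?P \<tau> \<longleftrightarrow> 0 \<le> \<tau> \<and> \<tau> \<le> t \<and> norm (x - p \<tau>) = c * (t - \<tau>)" for \<tau>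
  proof -
    have "t - \<tau> - norm (x - p \<tau>) / c = 0 \<longleftrightarrow> norm (x - p \<tau>) = c * (t - \<tau>)"
      using c by (auto simp: field_simps)
    moreover have "\<tau> \<le> t" if "norm (x - p \<tau>) = c * (t - \<tau>)"
    proof -
      have "0 \<le> c * (t - \<tau>)" using that norm_ge_zero by metis
      then show ?thesis using c by (simp add: zero_le_mult_iff)
    qed
    ultimately show ?thesis by blast
  qed
  have "continuous_on {0..t} p"
    using lipschitz_on_continuous_on[OF lip] t by (auto intro: continuous_on_subset)
  then have "continuous_on {0..t} (\<lambda>\<tau>. c * \<tau> + norm (x - p \<tau>))"
    by (intro continuous_intros)
  then obtain \<tau> where "0 \<le> \<tau>" "\<tau> \<le> t" "c * \<tau> + norm (x - p \<tau>) = c * t"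
    using IVT'[of "\<lambda>\<tau>. c * \<tau> + norm (x - p \<tau>)" 0 "c * t" t] arrived t c by auto
  then have ex: "?P \<tau>" unfolding P_iff by (simp add: algebra_simps)
  have uniq: "\<tau>1 = \<tau>2" if "?P \<tau>1" "?P \<tau>2" for \<tau>1 \<tau>2
  proof -
    have "c * \<bar>\<tau>1 - \<tau>2\<bar> = \<bar>norm (x - p \<tau>1) - norm (x - p \<tau>2)\<bar>"
      using that c unfolding P_iff by (simp add: right_diff_distrib[symmetric] abs_mult abs_minus_commute)
    also have "\<dots> \<le> L * \<bar>\<tau>1 - \<tau>2\<bar>"
      using that t unfolding P_iff by (intro range_dist_lipschitz[OF lip]) auto
    finally have "(c - L) * \<bar>\<tau>1 - \<tau>2\<bar> \<le> 0" by (simp add: algebra_simps)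
    with \<open>L < c\<close> show ?thesis by (simp add: mult_le_0_iff)
  qed
  have "?P (retarded_time c p x t)"
    unfolding retarded_time_def using theI[of ?P, OF ex] uniq[OF _ ex] by blast
  then show "0 \<le> retarded_time c p x t" and "retarded_time c p x t \<le> t"
    and "norm (x - p (retarded_time c p x t)) = c * (t - retarded_time c p x t)"
    unfolding P_iff by blast+
qed

lemma moving_source_field_arrived:
  assumes "c > 0" and "norm (x - p 0) \<le> c * t"
  shows "moving_source_field c s p x t =
    s (retarded_time c p x t) / (4 * pi * norm (x - p (retarded_time c p x t)))"
  using assms by (simp add: moving_source_field_def heaviside_def field_simps)

lemma moving_source_field_not_arrived:
  assumes "c > 0" and "\<not> norm (x - p 0) \<le> c * t"
  shows "moving_source_field c s p x t = 0"
  using assms by (simp add: moving_source_field_def heaviside_def field_simps)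

lemma moving_source_field_bound:
  assumes lip: "L-lipschitz_on {0..T} p" and "L < c" and t: "t \<in> {0..T}"
    and s: "\<And>\<tau>. \<tau> \<in> {0..T} \<Longrightarrow> \<bar>s \<tau>\<bar> \<le> B"
    and d: "d > 0" "\<And>\<tau>. \<tau> \<in> {0..T} \<Longrightarrow> d \<le> norm (x - p \<tau>)"
  shows "\<bar>moving_source_field c s p x t\<bar> \<le> B / (4 * pi * d)"
proof -
  have c: "c > 0" using lipschitz_on_nonneg[OF lip] \<open>L < c\<close> by simp
  have B: "0 \<le> B" using s[OF t] by linarith
  show ?thesis
  proof (cases "norm (x - p 0) \<le> c * t")
    case True
    let ?\<tau> = "retarded_time c p x t"
    have \<tau>: "?\<tau> \<in> {0..T}" using retarded_time_arrived[OF lip \<open>L < c\<close> t True] t by auto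
    have "\<bar>s ?\<tau>\<bar> / (4 * pi * norm (x - p ?\<tau>)) \<le> B / (4 * pi * d)"
      using s[OF \<tau>] d(2)[OF \<tau>] d(1) B by (intro frac_le) auto
    then show ?thesis
      using moving_source_field_arrived[where p=p and s=s, OF c True] by (simp add: abs_mult)
  next
    case False
    then show ?thesis using moving_source_field_not_arrived[where p=p and s=s, OF c False] B d(1) by simp
  qed
qed

section \<open>Stability of retarded times and fields\<close>

text \<open>Only the positions of the sources relative to their observers enter. Thus one estimate covers
  two observers of the same emitter as well as one observer of two scatterers. Comparing the
  ranges at the two retarded times costs \<open>\<delta>\<close> for the change of source and observer and
  \<open>L |\<tau>1 - \<tau>2|\<close> for the motion, and the latter is absorbed on the left since \<open>L < c\<close>.\<close>

lemma retarded_time_stability: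
  assumes lip: "L-lipschitz_on {0..T} p1" "L-lipschitz_on {0..T} p2"
    and "L < c" and t: "t \<in> {0..T}"
    and arrived: "norm (x1 - p1 0) \<le> c * t" "norm (x2 - p2 0) \<le> c * t"
    and close: "\<And>\<tau>. \<tau> \<in> {0..T} \<Longrightarrow> norm ((x1 - p1 \<tau>) - (x2 - p2 \<tau>)) \<le> \<delta>"
  shows "\<bar>retarded_time c p1 x1 t - retarded_time c p2 x2 t\<bar> \<le> \<delta> / (c - L)"
proof -
  define \<tau>1 where "\<tau>1 = retarded_time c p1 x1 t"
  define \<tau>2 where "\<tau>2 = retarded_time c p2 x2 t"
  note \<tau>1 = retarded_time_arrived[OF lip(1) \<open>L < c\<close> t arrived(1), folded \<tau>1_def]
  note \<tau>2 = retarded_time_arrived[OF lip(2) \<open>L < c\<close> t arrived(2), folded \<tau>2_def]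
  have c: "c > 0" using lipschitz_on_nonneg[OF lip(1)] \<open>L < c\<close> by simp
  have "c * \<bar>\<tau>1 - \<tau>2\<bar> = \<bar>norm (x1 - p1 \<tau>1) - norm (x2 - p2 \<tau>2)\<bar>"
    using \<tau>1 \<tau>2 c by (simp add: right_diff_distrib[symmetric] abs_mult)
  also have "\<dots> \<le> \<bar>norm (x1 - p1 \<tau>1) - norm (x2 - p2 \<tau>1)\<bar>
      + \<bar>norm (x2 - p2 \<tau>1) - norm (x2 - p2 \<tau>2)\<bar>"
    by linarith
  also have "\<dots> \<le> \<delta> + L * \<bar>\<tau>1 - \<tau>2\<bar>"
    using \<tau>1 \<tau>2 t close[of \<tau>1] norm_triangle_ineq3[of "x1 - p1 \<tau>1" "x2 - p2 \<tau>1"]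
    by (intro add_mono range_dist_lipschitz[OF lip(2)]) auto
  finally have "(c - L) * \<bar>\<tau>1 - \<tau>2\<bar> \<le> \<delta>" by (simp add: algebra_simps)
  then show ?thesis
    using \<open>L < c\<close> by (simp add: \<tau>1_def \<tau>2_def field_simps)
qed

text \<open>The strengths differ by \<open>\<epsilon>\<close> at equal times and by \<open>K\<close> times the difference of the retarded
  times in addition; the factor \<open>1 / r\<close> is Lipschitz with constant \<open>1 / d\<^sup>2\<close> at distances \<open>r \<ge> d\<close>.\<close>

lemma moving_source_field_stability:
  assumes lip: "L-lipschitz_on {0..T} p1" "L-lipschitz_on {0..T} p2"
    and "L < c" and t: "t \<in> {0..T}"
    and arrived: "norm (x1 - p1 0) \<le> c * t" "norm (x2 - p2 0) \<le> c * t"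
    and close: "\<And>\<tau>. \<tau> \<in> {0..T} \<Longrightarrow> norm ((x1 - p1 \<tau>) - (x2 - p2 \<tau>)) \<le> \<delta>"
    and d: "d > 0" "\<And>\<tau>. \<tau> \<in> {0..T} \<Longrightarrow> d \<le> norm (x1 - p1 \<tau>)"
      "\<And>\<tau>. \<tau> \<in> {0..T} \<Longrightarrow> d \<le> norm (x2 - p2 \<tau>)"
    and s: "\<And>\<tau>. \<tau> \<in> {0..T} \<Longrightarrow> \<bar>s1 \<tau> - s2 \<tau>\<bar> \<le> \<epsilon>"
      "\<And>\<tau>. \<tau> \<in> {0..T} \<Longrightarrow> \<bar>s2 \<tau>\<bar> \<le> B" "K-lipschitz_on {0..T} s2"
  shows "\<bar>moving_source_field c s1 p1 x1 t - moving_source_field c s2 p2 x2 t\<bar>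
    \<le> \<epsilon> / (4 * pi * d) + (K / d + B * c / d\<^sup>2) / (4 * pi * (c - L)) * \<delta>"
proof -
  define \<tau>1 where "\<tau>1 = retarded_time c p1 x1 t"
  define \<tau>2 where "\<tau>2 = retarded_time c p2 x2 t"
  define r1 where "r1 = norm (x1 - p1 \<tau>1)"
  define r2 where "r2 = norm (x2 - p2 \<tau>2)"
  note \<tau>1 = retarded_time_arrived[OF lip(1) \<open>L < c\<close> t arrived(1), folded \<tau>1_def]
  note \<tau>2 = retarded_time_arrived[OF lip(2) \<open>L < c\<close> t arrived(2), folded \<tau>2_def]
  have c: "c > 0" using lipschitz_on_nonneg[OF lip(1)] \<open>L < c\<close> by simp
  have K: "0 \<le> K" using s(3) by (rule lipschitz_on_nonneg)
  have \<tau>T: "\<tau>1 \<in> {0..T}" "\<tau>2 \<in> {0..T}" using \<tau>1 \<tau>2 t by auto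
  have B: "0 \<le> B" using s(2)[OF t] by linarith
  define \<eta> where "\<eta> = \<delta> / (c - L)"
  have \<tau>\<eta>: "\<bar>\<tau>1 - \<tau>2\<bar> \<le> \<eta>"
    unfolding \<tau>1_def \<tau>2_def \<eta>_def
    by (rule retarded_time_stability[OF lip \<open>L < c\<close> t arrived close])
  \<comment> \<open>A range is \<open>c\<close> times a delay, so ranges inherit the stability of retarded times.\<close>
  have "\<bar>r2 - r1\<bar> = c * \<bar>\<tau>1 - \<tau>2\<bar>"
    using \<tau>1 \<tau>2 c by (simp add: r1_def r2_def right_diff_distrib[symmetric] abs_mult)
  then have r: "\<bar>r2 - r1\<bar> \<le> c * \<eta>" using \<tau>\<eta> c by simp
  have rd: "d \<le> r1" "d \<le> r2" using d \<tau>T by (auto simp: r1_def r2_def)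
  then have rpos: "r1 > 0" "r2 > 0" using d(1) by linarith+
  have "\<bar>s1 \<tau>1 - s2 \<tau>2\<bar> \<le> \<bar>s1 \<tau>1 - s2 \<tau>1\<bar> + \<bar>s2 \<tau>1 - s2 \<tau>2\<bar>" by linarith
  also have "\<dots> \<le> \<epsilon> + K * \<eta>"
    using s(1)[OF \<tau>T(1)] lipschitz_onD[OF s(3) \<tau>T] mult_left_mono[OF \<tau>\<eta> K]
    by (simp add: dist_real_def)
  finally have strength: "\<bar>s1 \<tau>1 - s2 \<tau>2\<bar> \<le> \<epsilon> + K * \<eta>" .
  have "s1 \<tau>1 / r1 - s2 \<tau>2 / r2 = (s1 \<tau>1 - s2 \<tau>2) / r1 + s2 \<tau>2 * (r2 - r1) / (r1 * r2)"
    using rpos by (simp add: field_simps)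
  then have "\<bar>s1 \<tau>1 / r1 - s2 \<tau>2 / r2\<bar>
      \<le> \<bar>s1 \<tau>1 - s2 \<tau>2\<bar> / r1 + \<bar>s2 \<tau>2\<bar> * \<bar>r2 - r1\<bar> / (r1 * r2)"
    using rpos by (metis abs_divide abs_mult abs_of_pos abs_triangle_ineq mult_pos_pos)
  also have "\<dots> \<le> (\<epsilon> + K * \<eta>) / d + B * (c * \<eta>) / (d * d)"
    using strength r rd rpos d(1) B s(2)[OF \<tau>T(2)]
    by (intro add_mono frac_le mult_mono) auto
  finally have *: "\<bar>s1 \<tau>1 / r1 - s2 \<tau>2 / r2\<bar> \<le> (\<epsilon> + K * \<eta>) / d + B * (c * \<eta>) / (d * d)" .
  have "moving_source_field c s1 p1 x1 t = s1 \<tau>1 / r1 / (4 * pi)"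
    using moving_source_field_arrived[where p=p1 and s=s1, OF c arrived(1)]
    by (simp add: \<tau>1_def r1_def mult.commute)
  moreover have "moving_source_field c s2 p2 x2 t = s2 \<tau>2 / r2 / (4 * pi)"
    using moving_source_field_arrived[where p=p2 and s=s2, OF c arrived(2)]
    by (simp add: \<tau>2_def r2_def mult.commute)
  ultimately have "\<bar>moving_source_field c s1 p1 x1 t - moving_source_field c s2 p2 x2 t\<bar>
      = \<bar>s1 \<tau>1 / r1 - s2 \<tau>2 / r2\<bar> / (4 * pi)"
    using abs_divide[of "s1 \<tau>1 / r1 - s2 \<tau>2 / r2" "4 * pi"]
    by (simp only: diff_divide_distrib) simp
  also have "\<dots> \<le> ((\<epsilon> + K * \<eta>) / d + B * (c * \<eta>) / (d * d)) / (4 * pi)"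
    using * by (intro divide_right_mono) auto
  also have "\<dots> = \<epsilon> / (4 * pi * d) + (K / d + B * c / d\<^sup>2) / (4 * pi * (c - L)) * \<delta>"
  proof -
    have "(K / d + B * c / d\<^sup>2) / (4 * pi * (c - L)) * \<delta> = (K / d + B * c / d\<^sup>2) / (4 * pi) * \<eta>"
      by (simp add: \<eta>_def)
    moreover have "((\<epsilon> + K * \<eta>) / d + B * (c * \<eta>) / (d * d)) / (4 * pi)
        = \<epsilon> / (4 * pi * d) + (K / d + B * c / d\<^sup>2) / (4 * pi) * \<eta>"
      using d(1) by (simp add: field_simps power2_eq_square)
    ultimately show ?thesis by simp
  qed
  finally show ?thesis .
qed

section \<open>Incident fields at two nearby scatterers\<close>

text \<open>A time is in the mismatch set if the front emitted at time 0 from \<open>a\<close> has passed exactly one of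
  the two points. The signed distance \<open>c t - |y1 t - a|\<close> from the first point to the front is then
  at most \<open>\<delta>\<close> in absolute value. It grows with slope at least \<open>c - L\<close>, so the
  mismatch set has diameter at most \<open>2 \<delta> / (c - L)\<close>. Centring the window at any of its elements avoids
  having to construct the arrival times, which need not lie in \<open>[0,T]\<close>.\<close>

lemma arrival_mismatch_window:
  fixes y1 y2 :: "real \<Rightarrow> 'a::real_normed_vector"
  assumes lip: "L-lipschitz_on {0..T} y1" and "L < c"
    and close: "\<And>t. t \<in> {0..T} \<Longrightarrow> norm (y1 t - y2 t) \<le> \<delta>"
  obtains t0 where "\<And>t. t \<in> {0..T} \<Longrightarrow> (norm (y1 t - a) \<le> c * t) \<noteq> (norm (y2 t - a) \<le> c * t)
    \<Longrightarrow> \<bar>t - t0\<bar> \<le> 2 * \<delta> / (c - L)"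
proof -
  define M where "M = {t \<in> {0..T}. (norm (y1 t - a) \<le> c * t) \<noteq> (norm (y2 t - a) \<le> c * t)}"
  define k where "k t = c * t - norm (y1 t - a)" for t
  have small: "\<bar>k t\<bar> \<le> \<delta>" if "t \<in> M" for t
  proof -
    have "\<bar>norm (y1 t - a) - norm (y2 t - a)\<bar> \<le> \<delta>"
      using norm_triangle_ineq3[of "y1 t - a" "y2 t - a"] close[of t] that by (simp add: M_def)
    moreover have "norm (y1 t - a) \<le> c * t \<and> c * t < norm (y2 t - a) \<or>
        norm (y2 t - a) \<le> c * t \<and> c * t < norm (y1 t - a)"
      using that by (auto simp: M_def)
    ultimately show ?thesis
      unfolding k_def by linarith
  qed
  have "\<bar>t - t'\<bar> \<le> 2 * \<delta> / (c - L)" if "t \<in> M" "t' \<in> M" for t t'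
  proof -
    have "\<bar>norm (a - y1 t) - norm (a - y1 t')\<bar> \<le> L * \<bar>t - t'\<bar>"
      using that by (intro range_dist_lipschitz[OF lip]) (auto simp: M_def)
    moreover have "c * \<bar>t - t'\<bar> = \<bar>c * t - c * t'\<bar>"
      using lipschitz_on_nonneg[OF lip] \<open>L < c\<close> by (simp add: right_diff_distrib[symmetric] abs_mult)
    ultimately have "(c - L) * \<bar>t - t'\<bar> \<le> 2 * \<delta>"
      using small[OF that(1)] small[OF that(2)]
      by (simp add: k_def norm_minus_commute[of a] left_diff_distrib)
    then show ?thesis using \<open>L < c\<close> by (simp add: field_simps)
  qed
  then have diam: "\<And>t t'. t \<in> M \<Longrightarrow> t' \<in> M \<Longrightarrow> \<bar>t - t'\<bar> \<le> 2 * \<delta> / (c - L)" .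
  obtain t0 where "M \<noteq> {} \<Longrightarrow> t0 \<in> M" by blast
  show thesis
  proof (rule that)
    fix t assume "t \<in> {0..T}" "(norm (y1 t - a) \<le> c * t) \<noteq> (norm (y2 t - a) \<le> c * t)"
    then have "t \<in> M" by (simp add: M_def)
    then show "\<bar>t - t0\<bar> \<le> 2 * \<delta> / (c - L)"
      using diam \<open>M \<noteq> {} \<Longrightarrow> t0 \<in> M\<close> by blast
  qed
qed

text \<open>The jump at the front is confined to the mismatch window, where each of the two fields is
  bounded on its own. At all other times the fields are both zero or both given by
  the retarded strength over the distance.\<close>

lemma incident_field_difference_window:
  assumes z: "L-lipschitz_on {0..T} z" and y: "L-lipschitz_on {0..T} y1" and "L < c" and "0 \<le> T"
    and close: "\<And>t. t \<in> {0..T} \<Longrightarrow> norm (y1 t - y2 t) \<le> \<delta>"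
    and d: "d > 0" "\<And>t \<tau>. t \<in> {0..T} \<Longrightarrow> \<tau> \<in> {0..T} \<Longrightarrow> d \<le> norm (y1 t - z \<tau>)"
      "\<And>t \<tau>. t \<in> {0..T} \<Longrightarrow> \<tau> \<in> {0..T} \<Longrightarrow> d \<le> norm (y2 t - z \<tau>)"
    and \<phi>: "\<And>\<tau>. \<tau> \<in> {0..T} \<Longrightarrow> \<bar>\<phi> \<tau>\<bar> \<le> B" "K-lipschitz_on {0..T} \<phi>"
  obtains t0 where "\<And>t. t \<in> {0..T} \<Longrightarrow>
    \<bar>moving_source_field c \<phi> z (y1 t) t - moving_source_field c \<phi> z (y2 t) t\<bar>
    \<le> (K / d + B * c / d\<^sup>2) / (4 * pi * (c - L)) * \<delta>
      + (if t \<in> {t0 - 2 * \<delta> / (c - L)..t0 + 2 * \<delta> / (c - L)} then 2 * (B / (4 * pi * d)) else 0)"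
proof -
  let ?u1 = "\<lambda>t. moving_source_field c \<phi> z (y1 t) t"
  let ?u2 = "\<lambda>t. moving_source_field c \<phi> z (y2 t) t"
  let ?N = "(K / d + B * c / d\<^sup>2) / (4 * pi * (c - L)) * \<delta>"
  obtain t0 where t0: "\<And>t. t \<in> {0..T} \<Longrightarrow>
      (norm (y1 t - z 0) \<le> c * t) \<noteq> (norm (y2 t - z 0) \<le> c * t) \<Longrightarrow> \<bar>t - t0\<bar> \<le> 2 * \<delta> / (c - L)"
    using arrival_mismatch_window[OF y \<open>L < c\<close> close, where a = "z 0"] by metis
  have c: "c > 0" using lipschitz_on_nonneg[OF y] \<open>L < c\<close> by simp
  have K: "0 \<le> K" using \<phi>(2) by (rule lipschitz_on_nonneg)
  have T0: "0 \<in> {0..T}" using \<open>0 \<le> T\<close> by auto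
  have nonneg: "0 \<le> B" "0 \<le> \<delta>"
    using \<phi>(1)[OF T0] close[OF T0] norm_ge_zero[of "y1 0 - y2 0"] by linarith+
  have N: "0 \<le> ?N" using K c d(1) nonneg \<open>L < c\<close> by simp
  have U: "0 \<le> B / (4 * pi * d)" using d(1) nonneg by simp
  have "\<bar>?u1 t - ?u2 t\<bar> \<le> ?N
      + (if t \<in> {t0 - 2 * \<delta> / (c - L)..t0 + 2 * \<delta> / (c - L)} then 2 * (B / (4 * pi * d)) else 0)"
    if t: "t \<in> {0..T}" for t
  proof (cases "(norm (y1 t - z 0) \<le> c * t) = (norm (y2 t - z 0) \<le> c * t)")
    case True
    have "\<bar>?u1 t - ?u2 t\<bar> \<le> ?N"
    proof (cases "norm (y1 t - z 0) \<le> c * t")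
      case arr: True
      have "\<bar>?u1 t - ?u2 t\<bar> \<le> 0 / (4 * pi * d) + ?N"
      proof (rule moving_source_field_stability[OF z z \<open>L < c\<close> t arr _ _ d(1) d(2)[OF t] d(3)[OF t] _ \<phi>])
        show "norm (y2 t - z 0) \<le> c * t" using arr True by simp
      qed (use close[OF t] in simp_all)
      then show ?thesis by simp
    next
      case False
      then show ?thesis
        using True N moving_source_field_not_arrived[where p=z and s=\<phi>, OF c] by simp
    qed
    then show ?thesis using U by (auto intro: add_increasing2)
  next
    case False
    have "\<bar>?u1 t\<bar> \<le> B / (4 * pi * d)" "\<bar>?u2 t\<bar> \<le> B / (4 * pi * d)"
      using moving_source_field_bound[where s=\<phi>, OF z \<open>L < c\<close> t \<phi>(1) d(1)] d(2,3)[OF t] by blast+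
    then have "\<bar>?u1 t - ?u2 t\<bar> \<le> 2 * (B / (4 * pi * d))" by linarith
    moreover have "t \<in> {t0 - 2 * \<delta> / (c - L)..t0 + 2 * \<delta> / (c - L)}"
      using t0[OF t False] by (auto simp: abs_le_iff)
    ultimately show ?thesis using N by simp
  qed
  then show thesis by (rule that)
qed

section \<open>Damped linear equations with exceptional times\<close>

text \<open>The integrating factor turns \<open>w' + a w\<close> into the derivative of \<open>exp (- a (v - t)) w t\<close>, and the
  factor is at most 1 since \<open>a \<ge> 0\<close>. Finitely many points without derivative are admitted because
  an amplitude has a kink when the incident front arrives. With \<open>a = 0\<close> this is the mean
  value inequality.\<close>

lemma damped_growth_bound:
  fixes w w' h :: "real \<Rightarrow> real"
  assumes "u \<le> v" and "0 \<le> a" and "finite S" and w: "continuous_on {u..v} w"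
    and deriv: "\<And>t. t \<in> {u<..<v} - S \<Longrightarrow> (w has_real_derivative w' t) (at t)"
    and bound: "\<And>t. t \<in> {u<..<v} - S \<Longrightarrow> \<bar>w' t + a * w t\<bar> \<le> h t"
    and h: "h integrable_on {u..v}" "\<And>t. t \<in> {u..v} \<Longrightarrow> 0 \<le> h t"
  shows "\<bar>w v - exp (- a * (v - u)) * w u\<bar> \<le> integral {u..v} h"
proof -
  define F where "F t = exp (- a * (v - t)) * w t" for t
  define F' where
    "F' t = (if t \<in> {u<..<v} - S then exp (- a * (v - t)) * (w' t + a * w t) else 0)" for t
  have F_int: "(F' has_integral (F v - F u)) {u..v}"
  proof (rule fundamental_theorem_of_calculus_interior_strong[OF \<open>finite S\<close> \<open>u \<le> v\<close>])
    show "continuous_on {u..v} F"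
      unfolding F_def[abs_def] by (intro continuous_intros w)
    fix t assume t: "t \<in> {u<..<v} - S"
    have "(F has_real_derivative exp (- a * (v - t)) * (w' t + a * w t)) (at t)"
      unfolding F_def[abs_def]
      by (rule derivative_eq_intros deriv[OF t] | simp)+ (simp add: algebra_simps)
    then show "(F has_vector_derivative F' t) (at t)"
      using t by (simp add: F'_def has_real_derivative_iff_has_vector_derivative)
  qed
  have F'_le: "norm (F' t) \<le> h t" if "t \<in> {u..v}" for t
  proof (cases "t \<in> {u<..<v} - S")
    case True
    have "exp (- a * (v - t)) \<le> 1" using True \<open>0 \<le> a\<close> by simp
    then have "exp (- a * (v - t)) * \<bar>w' t + a * w t\<bar> \<le> 1 * h t"
      using bound[OF True] by (intro mult_mono) auto
    then show ?thesis using True by (simp add: F'_def abs_mult)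
  next
    case False
    then have "F' t = 0" unfolding F'_def by (rule if_not_P)
    then show ?thesis using h(2)[OF that] by simp
  qed
  have "\<bar>F v - F u\<bar> \<le> integral {u..v} h"
    using integral_norm_bound_integral[OF has_integral_integrable[OF F_int] h(1) F'_le]
      integral_unique[OF F_int] by simp
  then show ?thesis by (simp add: F_def)
qed

lemma integral_window_le:
  fixes A B :: real
  assumes "u \<le> v" and "l \<le> r" and "0 \<le> B"
  shows "(\<lambda>t. A + (if t \<in> {l..r} then B else 0)) integrable_on {u..v}"
    and "integral {u..v} (\<lambda>t. A + (if t \<in> {l..r} then B else 0)) \<le> A * (v - u) + B * (r - l)"
proof -
  have I: "{l..r} \<inter> {u..v} = {max l u..min r v}" by auto
  have "((\<lambda>t. B) has_integral measure lborel {max l u..min r v} *\<^sub>R B) {max l u..min r v}"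
    by (rule has_integral_const_real)
  then have "((\<lambda>t. if t \<in> {l..r} then B else 0) has_integral
      measure lborel {max l u..min r v} *\<^sub>R B) {u..v}"
    unfolding has_integral_restrict_Int I .
  from has_integral_add[OF has_integral_const_real[of A u v] this]
  have int: "((\<lambda>t. A + (if t \<in> {l..r} then B else 0)) has_integral
      measure lborel {u..v} *\<^sub>R A + measure lborel {max l u..min r v} *\<^sub>R B) {u..v}" .
  then show "(\<lambda>t. A + (if t \<in> {l..r} then B else 0)) integrable_on {u..v}"
    by (rule has_integral_integrable)
  have "measure lborel {max l u..min r v} \<le> r - l" using assms(2) by (auto simp: content_real_if)
  then have "measure lborel {max l u..min r v} * B \<le> (r - l) * B"
    using assms(3) by (rule mult_right_mono)
  then show "integral {u..v} (\<lambda>t. A + (if t \<in> {l..r} then B else 0)) \<le> A * (v - u) + B * (r - l)"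
    using integral_unique[OF int] assms(1) by (simp add: mult.commute)
qed

section \<open>Scatterer amplitudes\<close>

text \<open>A front moving at speed \<open>c\<close> passes a slower particle at most once.\<close>

lemma finite_arrival_times:
  fixes y :: "real \<Rightarrow> 'a::real_normed_vector"
  assumes lip: "L-lipschitz_on {0..T} y" and "L < c"
  shows "finite {t \<in> {0..T}. t = norm (y t - a) / c}"
proof -
  have c: "c > 0" using lipschitz_on_nonneg[OF lip] \<open>L < c\<close> by simp
  have "t = t'"
    if "t \<in> {0..T}" "t = norm (y t - a) / c" "t' \<in> {0..T}" "t' = norm (y t' - a) / c" for t t'
  proof -
    have "c * t = norm (a - y t)" "c * t' = norm (a - y t')"
      using that(2,4) c by (simp_all add: field_simps norm_minus_commute)
    then have "c * \<bar>t - t'\<bar> = \<bar>norm (a - y t) - norm (a - y t')\<bar>"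
      using c by (simp add: right_diff_distrib[symmetric] abs_mult flip: \<open>c * t = _\<close> \<open>c * t' = _\<close>)
    also have "\<dots> \<le> L * \<bar>t - t'\<bar>" using that by (intro range_dist_lipschitz[OF lip])
    finally have "(c - L) * \<bar>t - t'\<bar> \<le> 0" by (simp add: algebra_simps)
    with \<open>L < c\<close> show ?thesis by (simp add: mult_le_0_iff)
  qed
  then have unique: "t = t'"
    if "t \<in> {t \<in> {0..T}. t = norm (y t - a) / c}" "t' \<in> {t \<in> {0..T}. t = norm (y t - a) / c}" for t t'
    using that by blast
  show ?thesis
  proof (cases "{t \<in> {0..T}. t = norm (y t - a) / c} = {}")
    case False
    then obtain t0 where "t0 \<in> {t \<in> {0..T}. t = norm (y t - a) / c}" by blast
    then have "{t \<in> {0..T}. t = norm (y t - a) / c} \<subseteq> {t0}"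
      using unique by blast
    then show ?thesis by (rule finite_subset) simp
  qed (simp only: finite.emptyI)
qed

lemma scatterer_amplitude_has_derivative:
  assumes "scatterer_amplitude c T \<phi> z \<alpha> y q" and "t \<in> {0<..<T}" and "t \<noteq> norm (y t - z 0) / c"
  shows "(q has_real_derivative
    4 * pi * c * moving_source_field c \<phi> z (y t) t - 4 * pi * c * \<alpha> * q t) (at t)"
proof -
  have at: "at t within {0..T} = at t" using assms(2) by (simp add: at_within_Icc_at)
  have "q differentiable (at t within {0..T})"
    and eq: "velocity T q t + 4 * pi * c * \<alpha> * q t = 4 * pi * c * moving_source_field c \<phi> z (y t) t"
    using assms unfolding scatterer_amplitude_def by auto
  then have "(q has_real_derivative velocity T q t) (at t)"
    by (simp add: at vector_derivative_works velocity_def has_real_derivative_iff_has_vector_derivative)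
  moreover have "velocity T q t =
      4 * pi * c * moving_source_field c \<phi> z (y t) t - 4 * pi * c * \<alpha> * q t"
    using eq by simp
  ultimately show ?thesis by simp
qed

lemma scatterer_amplitude_bound:
  assumes q: "scatterer_amplitude c T \<phi> z \<alpha> y q" and lip: "L-lipschitz_on {0..T} y" and "L < c"
    and "0 \<le> \<alpha>" and U: "\<And>t. t \<in> {0..T} \<Longrightarrow> \<bar>moving_source_field c \<phi> z (y t) t\<bar> \<le> U"
    and t: "t \<in> {0..T}"
  shows "\<bar>q t\<bar> \<le> 4 * pi * c * U * T"
proof -
  have c: "c > 0" using lipschitz_on_nonneg[OF lip] \<open>L < c\<close> by simp
  have U0: "0 \<le> U" using U[OF t] by linarith
  let ?S = "{t \<in> {0..T}. t = norm (y t - z 0) / c}"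
  have q': "continuous_on {0..T} q" "q 0 = 0" using q by (simp_all add: scatterer_amplitude_def)
  have "\<bar>q t - exp (- (4 * pi * c * \<alpha>) * (t - 0)) * q 0\<bar> \<le> integral {0..t} (\<lambda>_. 4 * pi * c * U)"
  proof (rule damped_growth_bound[OF _ _ finite_arrival_times[OF lip \<open>L < c\<close>]])
    show "continuous_on {0..t} q"
      using t by (intro continuous_on_subset[OF q'(1)]) auto
    fix s assume s: "s \<in> {0<..<t} - ?S"
    then have "s \<in> {0<..<T}" "s \<noteq> norm (y s - z 0) / c" using t by auto
    then show "(q has_real_derivative
        4 * pi * c * moving_source_field c \<phi> z (y s) s - 4 * pi * c * \<alpha> * q s) (at s)"
      by (rule scatterer_amplitude_has_derivative[OF q])
    show "\<bar>4 * pi * c * moving_source_field c \<phi> z (y s) s - 4 * pi * c * \<alpha> * q s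
        + 4 * pi * c * \<alpha> * q s\<bar> \<le> 4 * pi * c * U"
      using U[of s] \<open>s \<in> {0<..<T}\<close> c by (simp add: abs_mult)
  qed (use t c U0 \<open>0 \<le> \<alpha>\<close> in auto)
  also have "\<dots> \<le> 4 * pi * c * U * T"
    using t c U0 mult_left_mono[of t T "4 * pi * c * U"] by (simp add: mult.commute)
  finally show ?thesis using q'(2) by simp
qed

text \<open>The equation bounds the derivative by the forcing and the bound on the amplitude itself.\<close>

lemma scatterer_amplitude_lipschitz:
  assumes q: "scatterer_amplitude c T \<phi> z \<alpha> y q" and lip: "L-lipschitz_on {0..T} y" and "L < c"
    and "0 \<le> \<alpha>" and "\<alpha> \<le> M" and "0 \<le> T"
    and U: "\<And>t. t \<in> {0..T} \<Longrightarrow> \<bar>moving_source_field c \<phi> z (y t) t\<bar> \<le> U"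
  shows "(4 * pi * c * U + 4 * pi * c * M * (4 * pi * c * U * T))-lipschitz_on {0..T} q"
proof (rule lipschitz_on_leI)
  have c: "c > 0" using lipschitz_on_nonneg[OF lip] \<open>L < c\<close> by simp
  have U0: "0 \<le> U" using U[of 0] \<open>0 \<le> T\<close> by auto
  let ?K = "4 * pi * c * U + 4 * pi * c * M * (4 * pi * c * U * T)"
  show K0: "0 \<le> ?K" using c U0 assms(4-6) by simp
  fix u v assume uv: "u \<in> {0..T}" "v \<in> {0..T}" "u \<le> v"
  let ?S = "{t \<in> {0..T}. t = norm (y t - z 0) / c}"
  have q': "continuous_on {0..T} q" using q by (simp add: scatterer_amplitude_def)
  have "\<bar>q v - exp (- 0 * (v - u)) * q u\<bar> \<le> integral {u..v} (\<lambda>_. ?K)"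
  proof (rule damped_growth_bound[OF uv(3) _ finite_arrival_times[OF lip \<open>L < c\<close>]])
    show "continuous_on {u..v} q"
      using uv by (intro continuous_on_subset[OF q']) auto
    fix s assume s: "s \<in> {u<..<v} - ?S"
    then have sT: "s \<in> {0<..<T}" "s \<noteq> norm (y s - z 0) / c" using uv by auto
    then show "(q has_real_derivative
        4 * pi * c * moving_source_field c \<phi> z (y s) s - 4 * pi * c * \<alpha> * q s) (at s)"
      by (rule scatterer_amplitude_has_derivative[OF q])
    have sT': "s \<in> {0..T}" using sT by auto
    have "\<bar>4 * pi * c * moving_source_field c \<phi> z (y s) s\<bar> \<le> 4 * pi * c * U"
      using U[OF sT'] c by (simp add: abs_mult)
    moreover have "\<bar>4 * pi * c * \<alpha> * q s\<bar> \<le> 4 * pi * c * M * (4 * pi * c * U * T)"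
      using scatterer_amplitude_bound[OF q lip \<open>L < c\<close> \<open>0 \<le> \<alpha>\<close> U sT'] c assms(4,5)
      unfolding abs_mult by (intro mult_mono) auto
    ultimately show "\<bar>4 * pi * c * moving_source_field c \<phi> z (y s) s - 4 * pi * c * \<alpha> * q s
        + 0 * q s\<bar> \<le> ?K"
      by linarith
  qed (use K0 in auto)
  then show "dist (q u) (q v) \<le> ?K * dist u v"
    using uv(3) by (simp add: dist_real_def abs_minus_commute mult.commute)
qed

lemma scatterer_amplitude_stability:
  assumes q: "scatterer_amplitude c T \<phi> z \<alpha>1 y1 q1" "scatterer_amplitude c T \<phi> z \<alpha>2 y2 q2"
    and lip: "L-lipschitz_on {0..T} y1" "L-lipschitz_on {0..T} y2" and "L < c"
    and "0 \<le> \<alpha>1" and t: "t \<in> {0..T}"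
    and Q: "\<And>s. s \<in> {0..T} \<Longrightarrow> \<bar>q2 s\<bar> \<le> Q"
    and u: "\<And>s. s \<in> {0..T} \<Longrightarrow>
      \<bar>moving_source_field c \<phi> z (y1 s) s - moving_source_field c \<phi> z (y2 s) s\<bar>
      \<le> A + (if s \<in> {l..r} then B else 0)"
    and "0 \<le> A" "0 \<le> B" "l \<le> r"
  shows "\<bar>q1 t - q2 t\<bar> \<le> 4 * pi * c * ((A + \<bar>\<alpha>1 - \<alpha>2\<bar> * Q) * T + B * (r - l))"
proof -
  have c: "c > 0" using lipschitz_on_nonneg[OF lip(1)] \<open>L < c\<close> by simp
  define k where "k = 4 * pi * c"
  have k: "k > 0" using c by (simp add: k_def)
  have Q0: "0 \<le> Q" using Q[OF t] by linarith
  let ?u1 = "\<lambda>s. moving_source_field c \<phi> z (y1 s) s"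
  let ?u2 = "\<lambda>s. moving_source_field c \<phi> z (y2 s) s"
  let ?S = "{t \<in> {0..T}. t = norm (y1 t - z 0) / c} \<union> {t \<in> {0..T}. t = norm (y2 t - z 0) / c}"
  let ?A = "k * (A + \<bar>\<alpha>1 - \<alpha>2\<bar> * Q)"
  let ?h = "\<lambda>s. ?A + (if s \<in> {l..r} then k * B else 0)"
  let ?w = "\<lambda>s. q1 s - q2 s"
  have q': "continuous_on {0..T} q1" "continuous_on {0..T} q2" "q1 0 = 0" "q2 0 = 0"
    using q by (simp_all add: scatterer_amplitude_def)
  have A0: "0 \<le> ?A" using k Q0 \<open>0 \<le> A\<close> by simp
  have "\<bar>?w t - exp (- (k * \<alpha>1) * (t - 0)) * ?w 0\<bar> \<le> integral {0..t} ?h"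
  proof (rule damped_growth_bound[where S = ?S])
    show "finite ?S" 
      by (rule finite_UnI[OF finite_arrival_times[OF lip(1) \<open>L < c\<close>] finite_arrival_times[OF lip(2) \<open>L < c\<close>]])
    show "continuous_on {0..t} ?w"
      using t by (intro continuous_intros continuous_on_subset[OF q'(1)] continuous_on_subset[OF q'(2)]) auto
    show "?h integrable_on {0..t}"
      using integral_window_le(1)[of 0 t l r "k * B" ?A] t k \<open>0 \<le> B\<close> \<open>l \<le> r\<close> by simp
    show "0 \<le> ?h s" for s using A0 k \<open>0 \<le> B\<close> by simp
    fix s assume s: "s \<in> {0<..<t} - ?S"
    then have sT: "s \<in> {0<..<T}" "s \<noteq> norm (y1 s - z 0) / c" "s \<noteq> norm (y2 s - z 0) / c"
      and sT': "s \<in> {0..T}" using t by auto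
    show "(?w has_real_derivative (k * ?u1 s - k * \<alpha>1 * q1 s) - (k * ?u2 s - k * \<alpha>2 * q2 s)) (at s)"
      using scatterer_amplitude_has_derivative[OF q(1) sT(1,2)]
        scatterer_amplitude_has_derivative[OF q(2) sT(1,3)]
      unfolding k_def by (rule DERIV_diff)
    \<comment> \<open>The difference of the amplitudes is damped at the rate of the first scatterer, and the
      second amplitude then acts as a source of size \<open>\<alpha>1 - \<alpha>2\<close>.\<close>
    have "(k * ?u1 s - k * \<alpha>1 * q1 s) - (k * ?u2 s - k * \<alpha>2 * q2 s) + k * \<alpha>1 * ?w s
        = k * ((?u1 s - ?u2 s) - (\<alpha>1 - \<alpha>2) * q2 s)"
      by (simp add: algebra_simps)
    moreover have "\<bar>(?u1 s - ?u2 s) - (\<alpha>1 - \<alpha>2) * q2 s\<bar>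
        \<le> (A + (if s \<in> {l..r} then B else 0)) + \<bar>\<alpha>1 - \<alpha>2\<bar> * Q"
    proof -
      have "\<bar>(\<alpha>1 - \<alpha>2) * q2 s\<bar> \<le> \<bar>\<alpha>1 - \<alpha>2\<bar> * Q"
        unfolding abs_mult using Q[OF sT'] by (rule mult_left_mono) simp
      then show ?thesis using u[OF sT'] by linarith
    qed
    ultimately have "\<bar>(k * ?u1 s - k * \<alpha>1 * q1 s) - (k * ?u2 s - k * \<alpha>2 * q2 s) + k * \<alpha>1 * ?w s\<bar>
        \<le> k * ((A + (if s \<in> {l..r} then B else 0)) + \<bar>\<alpha>1 - \<alpha>2\<bar> * Q)"
      using k by (simp add: abs_mult)
    also have "\<dots> = ?A + k * (if s \<in> {l..r} then B else 0)"
      by (simp only: distrib_left add_ac)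
    also have "\<dots> = ?h s" by (simp only: if_distrib[of "(*) k"] mult_zero_right)
    finally show "\<bar>(k * ?u1 s - k * \<alpha>1 * q1 s) - (k * ?u2 s - k * \<alpha>2 * q2 s) + k * \<alpha>1 * ?w s\<bar> \<le> ?h s"
      .
  qed (use t k \<open>0 \<le> \<alpha>1\<close> in auto)
  also have "\<dots> \<le> ?A * (t - 0) + k * B * (r - l)"
    using t k \<open>0 \<le> B\<close> \<open>l \<le> r\<close> by (intro integral_window_le) auto
  also have "\<dots> \<le> ?A * T + k * B * (r - l)"
    using t A0 by (intro add_mono mult_left_mono order_refl) auto
  finally show ?thesis using q'(3,4) by (simp add: k_def algebra_simps)
qed

section \<open>Scattered fields\<close>

text \<open>If the other signal has not arrived, then the distance \<open>|x1 - p1 0|\<close> is within \<open>\<delta>\<close> of \<open>c t\<close>, so the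
  first observer receives what its source emitted shortly after time 0.\<close>

lemma retarded_time_near_front:
  assumes lip: "L-lipschitz_on {0..T} p1"
    and "L < c" and t: "t \<in> {0..T}"
    and arrived: "norm (x1 - p1 0) \<le> c * t" "\<not> norm (x2 - p2 0) \<le> c * t"
    and close: "norm ((x1 - p1 0) - (x2 - p2 0)) \<le> \<delta>"
  shows "retarded_time c p1 x1 t \<le> \<delta> / (c - L)"
proof -
  define \<tau> where "\<tau> = retarded_time c p1 x1 t"
  note \<tau> = retarded_time_arrived[OF lip \<open>L < c\<close> t arrived(1), folded \<tau>_def]
  have "norm (x1 - p1 0) - norm (x1 - p1 \<tau>) \<le> L * \<tau>"
    using range_dist_lipschitz[OF lip, of 0 \<tau> x1] \<tau> t by auto
  moreover have "norm (x2 - p2 0) - norm (x1 - p1 0) \<le> \<delta>"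
    using norm_triangle_ineq3[of "x1 - p1 0" "x2 - p2 0"] close by linarith
  ultimately have "\<tau> * (c - L) \<le> \<delta>" using \<tau>(3) arrived(2) by (simp add: algebra_simps)
  then show ?thesis using \<open>L < c\<close> by (simp add: \<tau>_def field_simps)
qed

text \<open>The observer still receives emissions from times \<open>\<tau> \<le> \<delta> / (c - L)\<close>, when a strength that
  starts from 0 has grown to at most \<open>K \<tau>\<close>. This is why scattered fields, unlike the incident
  field, vary continuously across their fronts.\<close>

lemma continuous_strength_field_near_front:
  assumes lip: "L-lipschitz_on {0..T} p1"
    and "L < c" and t: "t \<in> {0..T}"
    and arrived: "norm (x - p1 0) \<le> c * t" "\<not> norm (x - p2 0) \<le> c * t"
    and close: "norm (p1 0 - p2 0) \<le> \<delta>"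
    and d: "d > 0" "\<And>\<tau>. \<tau> \<in> {0..T} \<Longrightarrow> d \<le> norm (x - p1 \<tau>)"
    and s: "s 0 = 0" "K-lipschitz_on {0..T} s"
  shows "\<bar>moving_source_field c s p1 x t\<bar> \<le> K / d / (4 * pi * (c - L)) * \<delta>"
proof -
  define \<tau> where "\<tau> = retarded_time c p1 x t"
  note \<tau> = retarded_time_arrived[OF lip \<open>L < c\<close> t arrived(1), folded \<tau>_def]
  have c: "c > 0" using lipschitz_on_nonneg[OF lip] \<open>L < c\<close> by simp
  have K: "0 \<le> K" using s(2) by (rule lipschitz_on_nonneg)
  have \<tau>T: "\<tau> \<in> {0..T}" using \<tau> t by auto
  have "norm ((x - p1 0) - (x - p2 0)) \<le> \<delta>" using close by (simp add: norm_minus_commute)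
  then have \<tau>_small: "\<tau> \<le> \<delta> / (c - L)"
    unfolding \<tau>_def by (rule retarded_time_near_front[where ?p2.0=p2, OF lip \<open>L < c\<close> t arrived])
  have "\<bar>s \<tau>\<bar> \<le> K * \<tau>"
    using lipschitz_onD[OF s(2) \<tau>T, of 0] s(1) \<tau> t by (simp add: dist_real_def)
  also have "\<dots> \<le> K * (\<delta> / (c - L))" using \<tau>_small K by (rule mult_left_mono)
  finally have "\<bar>s \<tau>\<bar> / (4 * pi * norm (x - p1 \<tau>)) \<le> K * (\<delta> / (c - L)) / (4 * pi * d)"
    using d(1) d(2)[OF \<tau>T] by (intro frac_le) auto
  then show ?thesis
    using moving_source_field_arrived[where p=p1 and s=s, OF c arrived(1)]
    by (simp add: \<tau>_def abs_mult mult.commute mult.left_commute)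
qed

text \<open>The bound for one arrived signal is dominated by the bound for two, so that one estimate holds
  for all positions of the observer relative to the two fronts.\<close>

lemma scattered_field_stability:
  assumes lip: "L-lipschitz_on {0..T} y1" "L-lipschitz_on {0..T} y2"
    and "L < c" and t: "t \<in> {0..T}"
    and close: "\<And>\<tau>. \<tau> \<in> {0..T} \<Longrightarrow> norm (y1 \<tau> - y2 \<tau>) \<le> \<delta>"
    and d: "d > 0" "\<And>\<tau>. \<tau> \<in> {0..T} \<Longrightarrow> d \<le> norm (x - y1 \<tau>)"
      "\<And>\<tau>. \<tau> \<in> {0..T} \<Longrightarrow> d \<le> norm (x - y2 \<tau>)"
    and q: "q1 0 = 0" "q2 0 = 0" "K-lipschitz_on {0..T} q1" "K-lipschitz_on {0..T} q2"
      "\<And>\<tau>. \<tau> \<in> {0..T} \<Longrightarrow> \<bar>q1 \<tau> - q2 \<tau>\<bar> \<le> \<epsilon>"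
      "\<And>\<tau>. \<tau> \<in> {0..T} \<Longrightarrow> \<bar>q2 \<tau>\<bar> \<le> B"
  shows "\<bar>moving_source_field c q1 y1 x t - moving_source_field c q2 y2 x t\<bar>
    \<le> \<epsilon> / (4 * pi * d) + (K / d + B * c / d\<^sup>2) / (4 * pi * (c - L)) * \<delta>"
proof -
  have c: "c > 0" using lipschitz_on_nonneg[OF lip(1)] \<open>L < c\<close> by simp
  have K: "0 \<le> K" using q(3) by (rule lipschitz_on_nonneg)
  have T0: "0 \<in> {0..T}" using t by auto
  have nonneg: "0 \<le> \<epsilon>" "0 \<le> B" "0 \<le> \<delta>"
    using q(5)[OF T0] q(6)[OF T0] close[OF T0] norm_ge_zero[of "y1 0 - y2 0"] by linarith+
  have front: "K / d / (4 * pi * (c - L)) * \<delta>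
      \<le> \<epsilon> / (4 * pi * d) + (K / d + B * c / d\<^sup>2) / (4 * pi * (c - L)) * \<delta>"
  proof -
    have "K / d / (4 * pi * (c - L)) * \<delta> \<le> (K / d + B * c / d\<^sup>2) / (4 * pi * (c - L)) * \<delta>"
      using nonneg c d(1) \<open>L < c\<close> by (intro mult_right_mono divide_right_mono) auto
    moreover have "0 \<le> \<epsilon> / (4 * pi * d)" using nonneg d(1) by simp
    ultimately show ?thesis by linarith
  qed
  have close': "norm (y2 0 - y1 0) \<le> \<delta>"
    using close[OF T0] by (simp add: norm_minus_commute)
  consider (both) "norm (x - y1 0) \<le> c * t" "norm (x - y2 0) \<le> c * t"
    | (first) "norm (x - y1 0) \<le> c * t" "\<not> norm (x - y2 0) \<le> c * t"
    | (second) "\<not> norm (x - y1 0) \<le> c * t" "norm (x - y2 0) \<le> c * t"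
    | (none) "\<not> norm (x - y1 0) \<le> c * t" "\<not> norm (x - y2 0) \<le> c * t"
    by blast
  then show ?thesis
  proof cases
    case both
    show ?thesis
    proof (rule moving_source_field_stability[OF lip \<open>L < c\<close> t both _ d q(5,6,4)])
      show "norm ((x - y1 \<tau>) - (x - y2 \<tau>)) \<le> \<delta>" if "\<tau> \<in> {0..T}" for \<tau>
        using close[OF that] by (simp add: norm_minus_commute)
    qed
  next
    case first
    show ?thesis
      using moving_source_field_not_arrived[where p=y2 and s=q2, OF c first(2)] front
        continuous_strength_field_near_front
          [where s=q1 and ?p2.0=y2, OF lip(1) \<open>L < c\<close> t first close[OF T0] d(1,2) q(1,3)]
      by simp
  next
    case second
    show ?thesis
      using moving_source_field_not_arrived[where p=y1 and s=q1, OF c second(1)] front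
        continuous_strength_field_near_front
          [where s=q2 and ?p2.0=y1, OF lip(2) \<open>L < c\<close> t second(2,1) close' d(1,3) q(2,4)]
      by simp
  next
    case none
    have "0 \<le> K / d / (4 * pi * (c - L)) * \<delta>" using K d(1) nonneg \<open>L < c\<close> by simp
    then show ?thesis
      using moving_source_field_not_arrived[where p=y1 and s=q1, OF c none(1)]
        moving_source_field_not_arrived[where p=y2 and s=q2, OF c none(2)] front
      by simp
  qed
qed

section \<open>Dependence of the scattered field on the scatterer\<close>

theorem theorem3p6:
  fixes c c0 T m_\<alpha> M_\<alpha> d_in d_sc :: real
    and \<phi> :: "real \<Rightarrow> real"
    and z :: "real \<Rightarrow> real^3"
  assumes "c > 0" and "0 < c0" and "c0 < c" and "T > 0"
    and "{m_\<alpha><..<M_\<alpha>} \<subseteq> {0<..}"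
    and "d_in > 0" and "d_sc > 0"
    and "C1_upto T \<phi>" and "\<And>t. t \<in> {0..T} \<Longrightarrow> \<phi> t > 0"
    and "C1_upto T z" and "\<And>t. t \<in> {0..T} \<Longrightarrow> norm (velocity T z t) < c0"
  shows "\<exists>C_sc>0.
    \<forall>(\<alpha> :: nat \<Rightarrow> real) (y :: nat \<Rightarrow> real \<Rightarrow> real^3) (q :: nat \<Rightarrow> real \<Rightarrow> real)
      (\<Omega>1 :: (real^3) set) (\<Omega>2 :: (real^3) set).
      compact \<Omega>1 \<and> setdist \<Omega>1 (z ` {0..T}) = d_in \<and>
      (\<forall>j\<in>{1,2}.
         \<alpha> j \<in> {m_\<alpha><..<M_\<alpha>} \<and>
         C1_upto T (y j) \<and> C0_norm T (velocity T (y j)) \<le> c0 \<and>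
         (\<forall>t\<in>{0..T}. y j t \<in> \<Omega>1) \<and>
         scatterer_amplitude c T \<phi> z (\<alpha> j) (y j) (q j)) \<and>
      compact \<Omega>2 \<and>
      Inf {norm (x - y j t) | x t j. x \<in> \<Omega>2 \<and> t \<in> {0..T} \<and> j \<in> {1,2}} = d_sc
      \<longrightarrow>
      (\<forall>x\<in>\<Omega>2. \<forall>t\<in>{0..T}.
         \<bar>moving_source_field c (q 1) (y 1) x t - moving_source_field c (q 2) (y 2) x t\<bar>
         \<le> C_sc * (\<bar>\<alpha> 1 - \<alpha> 2\<bar> + C0_norm T (\<lambda>t. y 1 t - y 2 t)))"
proof -
  \<comment> \<open>\<open>B\<close> and \<open>K\<close> bound the emitter strength and its derivative, \<open>U\<close> bounds the incident field on the
    scatterers, and \<open>N\<close> is its Lipschitz constant there away from the front.\<close>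
  define B where "B = C0_norm T \<phi>"
  define K where "K = C0_norm T (velocity T \<phi>)"
  define U where "U = B / (4 * pi * d_in)"
  define N where "N = (K / d_in + B * c / d_in\<^sup>2) / (4 * pi * (c - c0))"
  \<comment> \<open>\<open>Q\<close> bounds the amplitudes and \<open>Kq\<close> is their Lipschitz constant. The absolute value keeps it
    nonnegative also when the interval of admissible \<open>\<alpha>\<close> is empty.\<close>
  define Q where "Q = 4 * pi * c * U * T"
  define Kq where "Kq = 4 * pi * c * U + 4 * pi * c * \<bar>M_\<alpha>\<bar> * Q"
  \<comment> \<open>\<open>E\<alpha>\<close> and \<open>Ey\<close> measure the response of the amplitudes to changes of \<open>\<alpha>\<close> and \<open>y\<close>. The summand
    with 8 comes from the mismatch window: its length is \<open>4 \<delta> / (c - c0)\<close>, and there the incident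
    fields differ by up to \<open>2 U\<close>. \<open>P\<close> is the response of the scattered field to \<open>\<delta>\<close> through the
    retarded times.\<close>
  define E\<alpha> where "E\<alpha> = 4 * pi * c * Q * T"
  define Ey where "Ey = 4 * pi * c * (N * T + 8 * U / (c - c0))"
  define P where "P = (Kq / d_sc + Q * c / d_sc\<^sup>2) / (4 * pi * (c - c0))"
  define C where "C = E\<alpha> / (4 * pi * d_sc) + (Ey / (4 * pi * d_sc) + P) + 1"
  have T0: "0 \<in> {0..T}" using \<open>T > 0\<close> by simp
  have \<phi>_bound: "\<bar>\<phi> \<tau>\<bar> \<le> B" if "\<tau> \<in> {0..T}" for \<tau>
    using norm_le_C0_norm[OF C1_upto_continuous_on[OF \<open>C1_upto T \<phi>\<close>] that] by (simp add: B_def)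
  have B: "0 \<le> B" using \<phi>_bound[OF T0] by linarith
  have "continuous_on {0..T} (velocity T \<phi>)"
    using \<open>C1_upto T \<phi>\<close> by (simp add: C1_upto_def velocity_def[abs_def])
  from norm_le_C0_norm[OF this T0] have K: "0 \<le> K" unfolding K_def by (rule order_trans[OF norm_ge_zero])
  have \<phi>_lip: "K-lipschitz_on {0..T} \<phi>"
    using C1_upto_lipschitz_on_C0_norm[OF \<open>C1_upto T \<phi>\<close> _ K] by (simp add: K_def)
  have z_lip: "c0-lipschitz_on {0..T} z"
    using C1_upto_lipschitz_on[OF \<open>C1_upto T z\<close>] assms(11) \<open>0 < c0\<close> by (simp add: less_imp_le)
  have U: "0 \<le> U" using B \<open>d_in > 0\<close> by (simp add: U_def)
  have N: "0 \<le> N" using B K \<open>d_in > 0\<close> \<open>c > 0\<close> \<open>c0 < c\<close> by (simp add: N_def)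
  have Q: "0 \<le> Q" using U \<open>c > 0\<close> \<open>T > 0\<close> by (simp add: Q_def)
  have Kq: "0 \<le> Kq" using U Q \<open>c > 0\<close> by (simp add: Kq_def)
  have E: "0 \<le> E\<alpha>" "0 \<le> Ey"
    using U N Q \<open>c > 0\<close> \<open>T > 0\<close> \<open>c0 < c\<close> by (simp_all add: E\<alpha>_def Ey_def)
  have P: "0 \<le> P" using Q Kq \<open>c > 0\<close> \<open>d_sc > 0\<close> \<open>c0 < c\<close> by (simp add: P_def)
  have terms: "0 \<le> E\<alpha> / (4 * pi * d_sc)" "0 \<le> Ey / (4 * pi * d_sc)"
    using E \<open>d_sc > 0\<close> by simp_all
  then have C: "C > 0" using P by (simp add: C_def)
  show ?thesis
  proof (intro exI[of _ C] conjI C allI impI ballI)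
    fix \<alpha> :: "nat \<Rightarrow> real" and y :: "nat \<Rightarrow> real \<Rightarrow> real^3" and q :: "nat \<Rightarrow> real \<Rightarrow> real"
      and \<Omega>1 \<Omega>2 :: "(real^3) set" and x :: "real^3" and t :: real
    assume H: "compact \<Omega>1 \<and> setdist \<Omega>1 (z ` {0..T}) = d_in \<and>
      (\<forall>j\<in>{1,2}.
         \<alpha> j \<in> {m_\<alpha><..<M_\<alpha>} \<and>
         C1_upto T (y j) \<and> C0_norm T (velocity T (y j)) \<le> c0 \<and>
         (\<forall>t\<in>{0..T}. y j t \<in> \<Omega>1) \<and>
         scatterer_amplitude c T \<phi> z (\<alpha> j) (y j) (q j)) \<and>
      compact \<Omega>2 \<and>
      Inf {norm (x - y j t) | x t j. x \<in> \<Omega>2 \<and> t \<in> {0..T} \<and> j \<in> {1,2}} = d_sc"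
      and x: "x \<in> \<Omega>2" and t: "t \<in> {0..T}"
    define \<delta> where "\<delta> = C0_norm T (\<lambda>t. y 1 t - y 2 t)"
    define \<epsilon> where "\<epsilon> = E\<alpha> * \<bar>\<alpha> 1 - \<alpha> 2\<bar> + Ey * \<delta>"
    have j: "1 \<in> {1, 2::nat}" "2 \<in> {1, 2::nat}" by simp_all
    have amp: "scatterer_amplitude c T \<phi> z (\<alpha> j) (y j) (q j)" if "j \<in> {1,2}" for j
      using H that by blast
    have \<alpha>: "0 \<le> \<alpha> j" "\<alpha> j \<le> \<bar>M_\<alpha>\<bar>" if "j \<in> {1,2}" for j
    proof -
      have "\<alpha> j \<in> {m_\<alpha><..<M_\<alpha>}" using H that by blast
      then show "0 \<le> \<alpha> j" "\<alpha> j \<le> \<bar>M_\<alpha>\<bar>" using assms(5) by force+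
    qed
    have y_C1: "C1_upto T (y j)" if "j \<in> {1,2}" for j
      using H that by blast
    have y_lip: "c0-lipschitz_on {0..T} (y j)" if "j \<in> {1,2}" for j
      using H that \<open>0 < c0\<close> by (intro C1_upto_lipschitz_on_C0_norm) auto
    have near: "norm (y 1 \<tau> - y 2 \<tau>) \<le> \<delta>" if "\<tau> \<in> {0..T}" for \<tau>
      unfolding \<delta>_def
      by (rule norm_le_C0_norm[OF _ that])
        (intro continuous_intros C1_upto_continuous_on y_C1 j)
    have \<delta>: "0 \<le> \<delta>" using near[OF t] norm_ge_zero order_trans by blast
    have din: "d_in \<le> norm (y j s - z \<tau>)" if "j \<in> {1,2}" "s \<in> {0..T}" "\<tau> \<in> {0..T}" for j s \<tau>
    proof -
      have "y j s \<in> \<Omega>1" using H that by blast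
      then have "setdist \<Omega>1 (z ` {0..T}) \<le> dist (y j s) (z \<tau>)"
        using that(3) by (intro setdist_le_dist) auto
      then show ?thesis using H by (simp add: dist_norm)
    qed
    have dsc: "d_sc \<le> norm (x - y j \<tau>)" if "j \<in> {1,2}" "\<tau> \<in> {0..T}" for j \<tau>
    proof -
      have "Inf {norm (x - y j t) | x t j. x \<in> \<Omega>2 \<and> t \<in> {0..T} \<and> j \<in> {1,2}} \<le> norm (x - y j \<tau>)"
        by (rule cInf_lower) (use x that in blast, auto intro!: bdd_belowI[of _ 0])
      then show ?thesis using H by simp
    qed
    have u_bound: "\<bar>moving_source_field c \<phi> z (y j s) s\<bar> \<le> U" if "j \<in> {1,2}" "s \<in> {0..T}" for j s
      unfolding U_def
      using moving_source_field_bound[where s=\<phi>, OF z_lip \<open>c0 < c\<close> that(2) \<phi>_bound \<open>d_in > 0\<close> din[OF that]] .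
    have q_bound: "\<bar>q j s\<bar> \<le> Q" if "j \<in> {1,2}" "s \<in> {0..T}" for j s
      unfolding Q_def
      using scatterer_amplitude_bound[OF amp y_lip \<open>c0 < c\<close> \<alpha>(1) u_bound that(2)] that(1) by blast
    have q_lip: "Kq-lipschitz_on {0..T} (q j)" if "j \<in> {1,2}" for j
      unfolding Kq_def Q_def
      using scatterer_amplitude_lipschitz[OF amp y_lip \<open>c0 < c\<close> \<alpha> _ u_bound] that \<open>T > 0\<close> by simp
    have q_diff: "\<bar>q 1 s - q 2 s\<bar> \<le> \<epsilon>" if "s \<in> {0..T}" for s
    proof -
      define e where "e = 2 * \<delta> / (c - c0)"
      obtain t0 where t0: "\<And>t. t \<in> {0..T} \<Longrightarrow>
          \<bar>moving_source_field c \<phi> z (y 1 t) t - moving_source_field c \<phi> z (y 2 t) t\<bar>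
          \<le> N * \<delta> + (if t \<in> {t0 - e..t0 + e} then 2 * U else 0)"
        using incident_field_difference_window[OF z_lip y_lip[OF j(1)] \<open>c0 < c\<close> less_imp_le[OF \<open>T > 0\<close>] near
            \<open>d_in > 0\<close> din[OF j(1)] din[OF j(2)] \<phi>_bound \<phi>_lip, folded N_def U_def e_def] by metis
      have "0 \<le> e" using \<delta> \<open>c0 < c\<close> by (simp add: e_def)
      then have "\<bar>q 1 s - q 2 s\<bar>
          \<le> 4 * pi * c * ((N * \<delta> + \<bar>\<alpha> 1 - \<alpha> 2\<bar> * Q) * T + 2 * U * ((t0 + e) - (t0 - e)))"
        using N \<delta> U
        by (intro scatterer_amplitude_stability[OF amp[OF j(1)] amp[OF j(2)] y_lip[OF j(1)]
              y_lip[OF j(2)] \<open>c0 < c\<close> \<alpha>(1)[OF j(1)] that q_bound[OF j(2)] t0]) auto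
      also have "\<dots> = \<epsilon>"
        by (simp add: \<epsilon>_def E\<alpha>_def Ey_def e_def algebra_simps)
      finally show ?thesis .
    qed
    have q0: "q j 0 = 0" if "j \<in> {1,2}" for j
      using amp[OF that] by (simp add: scatterer_amplitude_def)
    have "\<bar>moving_source_field c (q 1) (y 1) x t - moving_source_field c (q 2) (y 2) x t\<bar>
        \<le> \<epsilon> / (4 * pi * d_sc) + P * \<delta>"
      unfolding P_def
      by (rule scattered_field_stability[OF y_lip[OF j(1)] y_lip[OF j(2)] \<open>c0 < c\<close> t near \<open>d_sc > 0\<close>
            dsc[OF j(1)] dsc[OF j(2)] q0[OF j(1)] q0[OF j(2)] q_lip[OF j(1)] q_lip[OF j(2)]
            q_diff q_bound[OF j(2)]])
    also have "\<dots> = E\<alpha> / (4 * pi * d_sc) * \<bar>\<alpha> 1 - \<alpha> 2\<bar> + (Ey / (4 * pi * d_sc) + P) * \<delta>"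
      by (simp add: \<epsilon>_def add_divide_distrib algebra_simps)
    also have "\<dots> \<le> C * \<bar>\<alpha> 1 - \<alpha> 2\<bar> + C * \<delta>"
      using terms P \<delta> by (intro add_mono mult_right_mono) (auto simp: C_def)
    finally show "\<bar>moving_source_field c (q 1) (y 1) x t - moving_source_field c (q 2) (y 2) x t\<bar>
         \<le> C * (\<bar>\<alpha> 1 - \<alpha> 2\<bar> + C0_norm T (\<lambda>t. y 1 t - y 2 t))"
      by (simp add: \<delta>_def distrib_left)
  qed
qed

end
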